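(* Let $n\ge 1$ and $T_i\in\mathcal{B}_A(\mathcal{H})$ for $1\le i\le n$. Then $$w_{\mathbb{A}}\left(\mathrm{diag}\left(\sum_{i=1}^nT_i,\ldots,\sum_{i=1}^nT_i\right)\right)\le n\,w_{\mathbb{A}}(\mathrm{diag}(T_1,\ldots,T_n)).$$
   Context: $\mathcal{H}$ is a complex Hilbert space with inner product $\langle\cdot,\cdot\rangle$, $\mathcal{B}(\mathcal{H})$ is the algebra of bounded linear operators on $\mathcal{H}$, and $A\in\mathcal{B}(\mathcal{H})$ is a positive operator, i.e. $A$ is selfadjoint and $\langle Ax,x\rangle\ge 0$ for all $x$. Put $\langle x,y\rangle_A=\langle Ax,y\rangle$ and $\|x\|_A=\sqrt{\langle x,x\rangle_A}$. $\mathcal{R}(\cdot)$ denotes range, and $\mathcal{B}_A(\mathcal{H})=\{T\in\mathcal{B}(\mathcal{H}):\mathcal{R}(T^*A)\subseteq\mathcal{R}(A)\}$ (the operators admitting an $A$-adjoint, i.e. some $X\in\mathcal{B}(\mathcal{H})$ with $AX=T^*A$). The $A$-numerical radius is $w_A(T)=\sup\{|\langle Tx,x\rangle_A|:x\in\mathcal{H},\ \|x\|_A=1\}$. $\mathbb{A}=\mathrm{diag}(A,\ldots,A)$ is the $n\times n$ diagonal operator matrix with all diagonal entries $A$, a positive operator on $\bigoplus_{i=1}^n\mathcal{H}$, and $w_{\mathbb{A}}$ is defined in the same way with $\bigoplus_{i=1}^n\mathcal{H}$ and $\mathbb{A}$ in place of $\mathcal{H}$ and $A$. $\mathrm{diag}(T_1,\ldots,T_n)$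 is the $n\times n$ diagonal operator matrix with diagonal entries $T_1,\ldots,T_n$; the matrix on the left-hand side has all $n$ diagonal entries equal to $\sum_{i=1}^nT_i$. *)

theory Defs
  imports "HOL-Analysis.Analysis"
begin

section \<open>Complex Hilbert spaces\<close>

text \<open>The inner product is linear in the first and conjugate-linear in the second argument.\<close>

class complex_inner = real_normed_vector +
  fixes scaleC :: "complex \<Rightarrow> 'a \<Rightarrow> 'a" (infixr \<open>*\<^sub>C\<close> 75)
    and cinner :: "'a \<Rightarrow> 'a \<Rightarrow> complex"
  assumes scaleR_scaleC: "r *\<^sub>R x = complex_of_real r *\<^sub>C x"
    and scaleC_add_right: "a *\<^sub>C (x + y) = a *\<^sub>C x + a *\<^sub>C y"
    and scaleC_add_left: "(a + b) *\<^sub>C x = a *\<^sub>C x + b *\<^sub>C x"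
    and scaleC_scaleC: "a *\<^sub>C b *\<^sub>C x = (a * b) *\<^sub>C x"
    and scaleC_one: "1 *\<^sub>C x = x"
    and cinner_commute: "cinner x y = cnj (cinner y x)"
    and cinner_add_left: "cinner (x + y) z = cinner x z + cinner y z"
    and cinner_scaleC_left: "cinner (a *\<^sub>C x) y = a * cinner x y"
    and cinner_self: "cinner x x = complex_of_real ((norm x)\<^sup>2)"

class chilbert_space = complex_inner + complete_space

instantiation complex :: chilbert_space
begin

definition scaleC_complex :: "complex \<Rightarrow> complex \<Rightarrow> complex" where
  "scaleC_complex a x = a * x"

definition cinner_complex :: "complex \<Rightarrow> complex \<Rightarrow> complex" where
  "cinner_complex x y = x * cnj y"

instance
proof
  fix r :: real and a b x y z :: complex
  show "r *\<^sub>R x = complex_of_real r *\<^sub>C x"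
    by (simp add: scaleC_complex_def scaleR_conv_of_real)
  show "a *\<^sub>C (x + y) = a *\<^sub>C x + a *\<^sub>C y"
    by (simp add: scaleC_complex_def distrib_left)
  show "(a + b) *\<^sub>C x = a *\<^sub>C x + b *\<^sub>C x"
    by (simp add: scaleC_complex_def distrib_right)
  show "a *\<^sub>C b *\<^sub>C x = (a * b) *\<^sub>C x" "1 *\<^sub>C x = x"
    by (simp_all add: scaleC_complex_def)
  show "cinner x y = cnj (cinner y x)" "cinner (a *\<^sub>C x) y = a * cinner x y"
    by (simp_all add: cinner_complex_def scaleC_complex_def)
  show "cinner (x + y) z = cinner x z + cinner y z"
    by (simp add: cinner_complex_def distrib_right)
  show "cinner x x = complex_of_real ((norm x)\<^sup>2)"
    unfolding cinner_complex_def by (rule complex_norm_square[symmetric])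
qed

end

text \<open>
  For a finite index type \<open>'n\<close> with \<open>n\<close> elements, \<open>'h ^ 'n\<close> is the direct sum of \<open>n\<close> copies
  of \<open>'h\<close>; the library norm on it is the \<open>\<ell>\<^sup>2\<close>-norm, as required for the Hilbert direct sum.
\<close>

instantiation vec :: (complex_inner, finite) complex_inner
begin

definition scaleC_vec :: "complex \<Rightarrow> 'a ^ 'b \<Rightarrow> 'a ^ 'b" where
  "scaleC_vec a x = (\<chi> i. a *\<^sub>C (x $ i))"

definition cinner_vec :: "'a ^ 'b \<Rightarrow> 'a ^ 'b \<Rightarrow> complex" where
  "cinner_vec x y = (\<Sum>i\<in>UNIV. cinner (x $ i) (y $ i))"

instance
proof
  fix r :: real and a b :: complex and x y z :: "'a ^ 'b"
  show "r *\<^sub>R x = complex_of_real r *\<^sub>C x"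
    by (simp add: vec_eq_iff scaleC_vec_def scaleR_scaleC)
  show "a *\<^sub>C (x + y) = a *\<^sub>C x + a *\<^sub>C y"
    by (simp add: vec_eq_iff scaleC_vec_def scaleC_add_right)
  show "(a + b) *\<^sub>C x = a *\<^sub>C x + b *\<^sub>C x"
    by (simp add: vec_eq_iff scaleC_vec_def scaleC_add_left)
  show "a *\<^sub>C b *\<^sub>C x = (a * b) *\<^sub>C x"
    by (simp add: vec_eq_iff scaleC_vec_def scaleC_scaleC)
  show "1 *\<^sub>C x = x"
    by (simp add: vec_eq_iff scaleC_vec_def scaleC_one)
  show "cinner x y = cnj (cinner y x)"
    unfolding cinner_vec_def cnj_sum by (rule sum.cong[OF refl]) (rule cinner_commute)
  show "cinner (x + y) z = cinner x z + cinner y z"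
    by (simp add: cinner_vec_def cinner_add_left sum.distrib)
  show "cinner (a *\<^sub>C x) y = a * cinner x y"
    by (simp add: cinner_vec_def scaleC_vec_def cinner_scaleC_left sum_distrib_left)
  show "cinner x x = complex_of_real ((norm x)\<^sup>2)"
    by (simp add: cinner_vec_def cinner_self norm_vec_def L2_set_def sum_nonneg)
qed

end

instance vec :: (chilbert_space, finite) chilbert_space ..


section \<open>Bounded operators and adjoints\<close>

definition bounded_clinear :: "('a::complex_inner \<Rightarrow> 'b::complex_inner) \<Rightarrow> bool" where
  "bounded_clinear T \<longleftrightarrow> bounded_linear T \<and> (\<forall>c x. T (c *\<^sub>C x) = c *\<^sub>C T x)"

text \<open>
  As for the real \<^const>\<open>adjoint\<close> of the library, the adjoint is selected by its defining
  identity. On a Hilbert space it exists and is unique: see \<open>cinner_cadjoint\<close> and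
  \<open>cadjoint_unique\<close> below.
\<close>

definition cadjoint :: "('a::complex_inner \<Rightarrow> 'b::complex_inner) \<Rightarrow> 'b \<Rightarrow> 'a" where
  "cadjoint T = (SOME S. \<forall>x y. cinner (T x) y = cinner x (S y))"

definition positive_op :: "('h::chilbert_space \<Rightarrow> 'h) \<Rightarrow> bool" where
  "positive_op A \<longleftrightarrow> bounded_clinear A \<and> cadjoint A = A \<and>
     (\<forall>x. cinner (A x) x \<in> \<real> \<and> 0 \<le> Re (cinner (A x) x))"

text \<open>The bounded operators \<open>T\<close> that admit an \<open>A\<close>-adjoint.\<close>

definition adjointable_ops :: "('h::chilbert_space \<Rightarrow> 'h) \<Rightarrow> ('h \<Rightarrow> 'h) set" where
  "adjointable_ops A = {T. bounded_clinear T \<and> range (cadjoint T \<circ> A) \<subseteq> range A}"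


section \<open>The \<open>A\<close>-numerical radius\<close>

definition A_inner :: "('h::chilbert_space \<Rightarrow> 'h) \<Rightarrow> 'h \<Rightarrow> 'h \<Rightarrow> complex" where
  "A_inner A x y = cinner (A x) y"

definition A_norm :: "('h::chilbert_space \<Rightarrow> 'h) \<Rightarrow> 'h \<Rightarrow> real" where
  "A_norm A x = sqrt (Re (A_inner A x x))"

text \<open>
  The supremum is taken in \<open>[0, \<infinity>]\<close>: it may be infinite for a general bounded \<open>T\<close>, and the
  supremum over the empty set (which occurs exactly for \<open>A = 0\<close>) is \<open>0\<close>.
\<close>

definition A_numerical_radius ::
  "('h::chilbert_space \<Rightarrow> 'h) \<Rightarrow> ('h \<Rightarrow> 'h) \<Rightarrow> ennreal" where
  "A_numerical_radius A T = (SUP x\<in>{x. A_norm A x = 1}. ennreal (cmod (A_inner A (T x) x)))"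


section \<open>Operator matrices\<close>

definition op_matrix :: "('n::finite \<Rightarrow> 'n \<Rightarrow> 'h::complex_inner \<Rightarrow> 'h) \<Rightarrow> 'h ^ 'n \<Rightarrow> 'h ^ 'n" where
  "op_matrix M x = (\<chi> i. \<Sum>j\<in>UNIV. M i j (x $ j))"

definition op_diag :: "('n::finite \<Rightarrow> 'h::complex_inner \<Rightarrow> 'h) \<Rightarrow> 'h ^ 'n \<Rightarrow> 'h ^ 'n" where
  "op_diag D = op_matrix (\<lambda>i j. if i = j then D i else (\<lambda>_. 0))"

lemma op_diag_nth: "op_diag D x $ i = D i (x $ i)"
proof -
  have "op_diag D x $ i = (\<Sum>j\<in>UNIV. if i = j then D i (x $ j) else 0)"
    unfolding op_diag_def op_matrix_def vec_lambda_beta by (rule sum.cong) auto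
  then show ?thesis by simp
qed


section \<open>Existence and uniqueness of adjoints\<close>

lemma scaleC_zero_left: "0 *\<^sub>C x = (0::'a::complex_inner)"
  using scaleC_add_left[of 0 0 x] by simp

lemma cinner_zero_left [simp]: "cinner 0 x = (0::complex)"
  using cinner_add_left[of 0 0 x] by simp

lemma cinner_minus_left: "cinner (- x) y = - cinner x y"
  using cinner_add_left[of x "- x" y] by (simp add: eq_neg_iff_add_eq_0 add.commute)

lemma cinner_diff_left: "cinner (x - y) z = cinner x z - cinner y z"
  using cinner_add_left[of x "- y" z] by (simp add: cinner_minus_left)

lemma cinner_add_right: "cinner x (y + z) = cinner x y + cinner x z"
  by (metis cinner_add_left cinner_commute complex_cnj_add)

lemma cinner_diff_right: "cinner x (y - z) = cinner x y - cinner x z"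
  by (metis cinner_diff_left cinner_commute complex_cnj_diff)

lemma cinner_scaleC_right: "cinner x (a *\<^sub>C y) = cnj a * cinner x y"
  by (metis cinner_scaleC_left cinner_commute complex_cnj_mult)

lemma norm_add_sq: "(norm (x + y))\<^sup>2 = (norm x)\<^sup>2 + 2 * Re (cinner x y) + (norm (y::'a::complex_inner))\<^sup>2"
proof -
  have "cinner (x + y) (x + y) = cinner x x + cinner y y + (cinner x y + cnj (cinner x y))"
    using cinner_commute[of y x] by (simp add: cinner_add_left cinner_add_right)
  then have "Re (cinner (x + y) (x + y)) = Re (cinner x x + cinner y y + (cinner x y + cnj (cinner x y)))"
    by simp
  then show ?thesis by (simp add: cinner_self)
qed

lemma norm_diff_sq: "(norm (x - y))\<^sup>2 = (norm x)\<^sup>2 - 2 * Re (cinner x y) + (norm (y::'a::complex_inner))\<^sup>2"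
proof -
  have "cinner x (- y) = - cinner x y"
    using cinner_diff_right[of x 0 y] cinner_diff_right[of x 0 0] by simp
  then show ?thesis using norm_add_sq[of x "- y"] by simp
qed

lemma cinner_eqI:
  assumes "\<And>x. cinner x y = cinner x (z::'a::complex_inner)"
  shows "y = z"
proof -
  have "cinner (y - z) (y - z) = 0"
    using assms[of "y - z"] by (simp add: cinner_diff_right)
  then show ?thesis by (simp add: cinner_self)
qed

theorem riesz_representation:
  fixes f :: "'h::chilbert_space \<Rightarrow> complex"
  assumes f: "bounded_clinear f"
  shows "\<exists>z. \<forall>x. f x = cinner x z"
proof -
  have lin: "bounded_linear f" and fC: "\<And>c x. f (c *\<^sub>C x) = c * f x"
    using f by (auto simp: bounded_clinear_def scaleC_complex_def)
  interpret bounded_linear f by (rule lin)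
  obtain K where K: "\<And>x. norm (f x) \<le> norm x * K" using bounded by blast
  define g where "g x = (norm x)\<^sup>2 - 2 * Re (f x)" for x
  have bnd: "- K\<^sup>2 \<le> g x" for x
  proof -
    have "Re (f x) \<le> norm x * K" using K[of x] complex_Re_le_cmod[of "f x"] by linarith
    moreover have "0 \<le> (norm x - K)\<^sup>2" by simp
    ultimately show ?thesis unfolding g_def by (simp add: power2_diff)
  qed
  define m where "m = (INF x. g x)"
  have bb: "bdd_below (range g)" using bnd by (intro bdd_belowI2)
  have m_le: "m \<le> g x" for x unfolding m_def using bb by (rule cINF_lower) simp
  have "\<exists>x. g x < m + 1 / real (Suc k)" for k
    using cINF_less_iff[OF _ bb, of "m + 1 / real (Suc k)"] unfolding m_def by auto
  then obtain X where X: "\<And>k. g (X k) < m + 1 / real (Suc k)" by metis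
  have par: "(norm (x - y))\<^sup>2 \<le> 2 * (g x + g y - 2 * m)" for x y
  proof -
    have h: "norm ((1/2) *\<^sub>R (x + y)) = norm (x + y) / 2" by simp
    have "Re (f ((1/2) *\<^sub>R (x + y))) = (Re (f x) + Re (f y)) / 2" by (simp add: scaleR add)
    then have "g ((1/2) *\<^sub>R (x + y)) = (norm (x + y))\<^sup>2 / 4 - (Re (f x) + Re (f y))"
      unfolding g_def h by (simp add: power_divide)
    then have "m \<le> (norm (x + y))\<^sup>2 / 4 - (Re (f x) + Re (f y))"
      using m_le[of "(1/2) *\<^sub>R (x + y)"] by simp
    moreover have "(norm (x - y))\<^sup>2 = 2 * (norm x)\<^sup>2 + 2 * (norm y)\<^sup>2 - (norm (x + y))\<^sup>2"
      using norm_add_sq[of x y] norm_diff_sq[of x y] by simp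
    ultimately show ?thesis unfolding g_def by (simp add: algebra_simps)
  qed
  have "Cauchy X"
  proof (rule metric_CauchyI)
    fix e :: real assume e: "0 < e"
    obtain N where N: "1 / real (Suc N) < e\<^sup>2 / 4"
      using e reals_Archimedean[of "e\<^sup>2 / 4"] by (auto simp: inverse_eq_divide)
    have "dist (X i) (X j) < e" if "i \<ge> N" "j \<ge> N" for i j
    proof -
      have g_le: "g (X k) < m + e\<^sup>2 / 4" if "k \<ge> N" for k
      proof -
        have "1 / real (Suc k) \<le> 1 / real (Suc N)" using that by (auto simp: frac_le)
        then have "1 / real (Suc k) < e\<^sup>2 / 4" using N by (rule order_le_less_trans)
        then have "m + 1 / real (Suc k) < m + e\<^sup>2 / 4" by (rule add_strict_left_mono)
        then show ?thesis using X[of k] by (rule order_less_trans[rotated])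
      qed
      have "g (X i) + g (X j) < (m + e\<^sup>2 / 4) + (m + e\<^sup>2 / 4)"
        using that by (intro add_strict_mono g_le)
      then have "2 * (g (X i) + g (X j) - 2 * m) < e\<^sup>2" by (simp add: field_simps)
      then have "(norm (X i - X j))\<^sup>2 < e\<^sup>2"
        using par[of "X i" "X j"] by (rule order_le_less_trans[rotated])
      then show ?thesis using e by (simp add: dist_norm power2_less_imp_less)
    qed
    then show "\<exists>M. \<forall>i\<ge>M. \<forall>j\<ge>M. dist (X i) (X j) < e" by blast
  qed
  then obtain z where z: "X \<longlonglongrightarrow> z" using Cauchy_convergent convergent_def by blast
  have "(\<lambda>k. g (X k)) \<longlonglongrightarrow> g z" unfolding g_def
    by (intro tendsto_intros z tendsto)
  moreover have "(\<lambda>k. m + 1 / real (Suc k)) \<longlonglongrightarrow> m + 0"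
    using tendsto_add[OF tendsto_const LIMSEQ_inverse_real_of_nat] by (simp only: inverse_eq_divide)
  ultimately have "g z \<le> m + 0"
    by (rule LIMSEQ_le) (intro exI[of _ 0] allI impI less_imp_le X)
  then have zmin: "g z \<le> g x" for x using m_le[of x] by simp
  have re: "Re (f v) = Re (cinner v z)" for v
  proof (rule ccontr)
    define d where "d = Re (f v) - Re (cinner v z)"
    assume "Re (f v) \<noteq> Re (cinner v z)"
    then have d: "d \<noteq> 0" by (simp add: d_def)
    have q: "2 * t * d \<le> t\<^sup>2 * (norm v)\<^sup>2" for t
    proof -
      have "Re (cinner z (t *\<^sub>R v)) = t * Re (cinner v z)"
        using cinner_commute[of z v] by (simp add: scaleR_scaleC cinner_scaleC_right)
      then have "(norm (z + t *\<^sub>R v))\<^sup>2 = (norm z)\<^sup>2 + 2 * (t * Re (cinner v z)) + t\<^sup>2 * (norm v)\<^sup>2"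
        using norm_add_sq[of z "t *\<^sub>R v"] by (simp add: power_mult_distrib)
      moreover have "Re (f (z + t *\<^sub>R v)) = Re (f z) + t * Re (f v)" by (simp add: add scaleR)
      ultimately show ?thesis using zmin[of "z + t *\<^sub>R v"] unfolding g_def d_def
        by (simp add: algebra_simps)
    qed
    define s where "s = 1 / (1 + (norm v)\<^sup>2)"
    have s: "s > 0" "s * (norm v)\<^sup>2 < 1" unfolding s_def by (auto simp: field_simps add_pos_nonneg)
    have "d\<^sup>2 > 0" using d by simp
    have "s * (2 * d\<^sup>2) \<le> s * (d\<^sup>2 * (s * (norm v)\<^sup>2))"
      using q[of "s * d"] by (simp add: power2_eq_square algebra_simps)
    then have "2 * d\<^sup>2 \<le> d\<^sup>2 * (s * (norm v)\<^sup>2)" using s by simp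
    also have "\<dots> \<le> d\<^sup>2 * 1" using s by (intro mult_left_mono) auto
    finally show False using \<open>d\<^sup>2 > 0\<close> by simp
  qed
  have "f v = cinner v z" for v
    using re[of v] re[of "\<i> *\<^sub>C v"] by (simp add: complex_eq_iff fC cinner_scaleC_left)
  then show ?thesis by blast
qed

lemma bounded_clinear_cinner_left: "bounded_clinear (\<lambda>x. cinner x (y::'a::complex_inner))"
proof -
  have cs: "cmod (cinner x y) \<le> norm x * norm y" for x :: 'a
  proof (cases "y = 0")
    case True
    then show ?thesis using cinner_commute[of x 0] by simp
  next
    case False
    define c where "c = cinner x y / of_real ((norm y)\<^sup>2)"
    have ny: "(norm y)\<^sup>2 > 0" using False by simp
    have "cinner x (c *\<^sub>C y) = of_real ((cmod (cinner x y))\<^sup>2 / (norm y)\<^sup>2)"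
      using complex_norm_square[of "cinner x y"]
      by (simp add: cinner_scaleC_right c_def mult.commute)
    then have q: "Re (cinner x (c *\<^sub>C y)) = (cmod (cinner x y))\<^sup>2 / (norm y)\<^sup>2" by simp
    have "cinner (c *\<^sub>C y) (c *\<^sub>C y) = (c * of_real ((norm y)\<^sup>2)) * cnj c"
      unfolding cinner_scaleC_right cinner_scaleC_left by (simp add: cinner_self)
    also have "c * of_real ((norm y)\<^sup>2) = cinner x y" using False by (simp add: c_def)
    also have "cinner x y * cnj c = of_real ((cmod (cinner x y))\<^sup>2 / (norm y)\<^sup>2)"
      using complex_norm_square[of "cinner x y"] by (simp add: c_def)
    finally have "(norm (c *\<^sub>C y))\<^sup>2 = (cmod (cinner x y))\<^sup>2 / (norm y)\<^sup>2"
      unfolding cinner_self of_real_eq_iff .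
    then have "(norm (x - c *\<^sub>C y))\<^sup>2 = (norm x)\<^sup>2 - (cmod (cinner x y))\<^sup>2 / (norm y)\<^sup>2"
      using norm_diff_sq[of x "c *\<^sub>C y"] q by simp
    then have "0 \<le> (norm x)\<^sup>2 - (cmod (cinner x y))\<^sup>2 / (norm y)\<^sup>2"
      using zero_le_power2[of "norm (x - c *\<^sub>C y)"] by simp
    then have "(cmod (cinner x y))\<^sup>2 \<le> (norm x * norm y)\<^sup>2"
      using ny by (simp add: field_simps power_mult_distrib)
    then show ?thesis by (rule power2_le_imp_le) simp
  qed
  have "bounded_linear (\<lambda>x. cinner x y)"
    by (rule bounded_linear_intro[where K="norm y"])
      (auto simp: cinner_add_left scaleR_scaleC cinner_scaleC_left scaleR_conv_of_real cs
        scaleC_complex_def)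
  then show ?thesis
    by (simp add: bounded_clinear_def cinner_scaleC_left scaleC_complex_def)
qed

theorem cinner_cadjoint:
  fixes T :: "'h::chilbert_space \<Rightarrow> 'k::complex_inner"
  assumes T: "bounded_clinear T"
  shows "cinner (T x) y = cinner x (cadjoint T y)"
proof -
  have "bounded_clinear (\<lambda>x. cinner (T x) y)" for y
    using T bounded_clinear_cinner_left[of y]
      bounded_linear_compose[of "\<lambda>x. cinner x y" T] by (simp add: bounded_clinear_def)
  then have "\<forall>y. \<exists>z. \<forall>x. cinner (T x) y = cinner x z"
    using riesz_representation by blast
  then have "\<exists>S. \<forall>x y. cinner (T x) y = cinner x (S y)" by metis
  then have "\<forall>x y. cinner (T x) y = cinner x (cadjoint T y)"
    unfolding cadjoint_def by (rule someI_ex)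
  then show ?thesis by blast
qed

lemma cadjoint_unique:
  fixes T :: "'h::complex_inner \<Rightarrow> 'k::complex_inner"
  assumes S: "\<And>x y. cinner (T x) y = cinner x (S y)"
  shows "cadjoint T = S"
proof -
  have "\<forall>x y. cinner (T x) y = cinner x (cadjoint T y)"
    unfolding cadjoint_def by (rule someI[where x=S]) (simp add: S)
  then have "cinner x (cadjoint T y) = cinner x (S y)" for x y using S by simp
  then have "cadjoint T y = S y" for y by (rule cinner_eqI)
  then show ?thesis by (rule ext)
qed

end

theory Submission
  imports Defs
begin

text \<open>
  On a vector \<open>x = (x\<^sub>1, \<dots>, x\<^sub>n)\<close> of the direct sum, the quadratic form of the constant diagonal
  with entry \<open>\<Sum>\<^sub>i T\<^sub>i\<close> splits into the \<open>n\<^sup>2\<close> numbers \<open>\<langle>T\<^sub>i x\<^sub>j, x\<^sub>j\<rangle>\<^sub>A\<close>. Each of them is at most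
  \<open>w\<^sub>A(T\<^sub>i) \<parallel>x\<^sub>j\<parallel>\<^sub>A\<^sup>2\<close> in modulus, and \<open>w\<^sub>A(T\<^sub>i)\<close> is at most the radius \<open>w\<close> of
  \<open>diag(T\<^sub>1, \<dots>, T\<^sub>n)\<close>, because \<open>T\<^sub>i\<close> is the compression of the diagonal to its \<open>i\<close>-th summand.
  Since \<open>\<Sum>\<^sub>j \<parallel>x\<^sub>j\<parallel>\<^sub>A\<^sup>2 = 1\<close> for a unit vector, summing over \<open>j\<close> gives \<open>w\<close> for every \<open>i\<close>, and
  summing over \<open>i\<close> gives \<open>n w\<close>.

  The delicate point is the estimate \<open>\<bar>\<langle>T u, u\<rangle>\<^sub>A\<bar> \<le> w\<^sub>A(T) \<parallel>u\<parallel>\<^sub>A\<^sup>2\<close> at vectors with \<open>\<parallel>u\<parallel>\<^sub>A = 0\<close>,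
  which cannot be normalised. Positivity of \<open>A\<close> forces \<open>A u = 0\<close> there, so the left-hand side
  vanishes (\<open>positive_op_null\<close>, \<open>cmod_A_inner_le_A_numerical_radius\<close>). All estimates are carried
  out in \<open>[0, \<infinity>]\<close>, where \<open>\<infinity> * 0 = 0\<close>, so that an infinite radius needs no separate treatment.
\<close>

lemma op_diag_const_A_inner:
  "A_inner (op_diag (\<lambda>_. A)) x y = (\<Sum>i\<in>UNIV. A_inner A (x $ i) (y $ i))"
  by (simp add: A_inner_def cinner_vec_def op_diag_nth)

lemma positive_op_bounded_clinear: "positive_op A \<Longrightarrow> bounded_clinear A"
  by (simp add: positive_op_def)

lemma positive_op_cinner_commute:
  assumes "positive_op A"
  shows "cinner (A x) y = cinner x (A y)"
  using cinner_cadjoint[of A x y] assms by (simp add: positive_op_def)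

lemma positive_op_A_inner_nonneg: "positive_op A \<Longrightarrow> 0 \<le> Re (A_inner A x x)"
  by (simp add: positive_op_def A_inner_def)

lemma bounded_clinear_scaleR: "bounded_clinear T \<Longrightarrow> T (r *\<^sub>R x) = r *\<^sub>R T x"
  by (simp add: bounded_clinear_def scaleR_scaleC)

lemma bounded_clinear_add: "bounded_clinear T \<Longrightarrow> T (x + y) = T x + T y"
  by (simp add: bounded_clinear_def linear_simps)

lemma bounded_clinear_zero: "bounded_clinear T \<Longrightarrow> T 0 = 0"
  by (simp add: bounded_clinear_def linear_simps)

lemma cinner_scaleR_left: "cinner (r *\<^sub>R x) y = of_real r * cinner x y"
  by (simp add: scaleR_scaleC cinner_scaleC_left)

lemma cinner_scaleR_right: "cinner x (r *\<^sub>R y) = of_real r * cinner x y"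
  by (simp add: scaleR_scaleC cinner_scaleC_right)

lemma A_inner_sum_left:
  assumes "bounded_clinear A"
  shows "A_inner A (\<Sum>i\<in>I. f i) y = (\<Sum>i\<in>I. A_inner A (f i) y)"
proof (induction I rule: infinite_finite_induct)
  case (insert i I)
  then show ?case
    using assms by (simp add: A_inner_def bounded_clinear_add cinner_add_left)
qed (simp_all add: A_inner_def bounded_clinear_zero[OF assms])

lemma A_inner_scaleR:
  assumes "bounded_clinear A"
  shows "A_inner A (r *\<^sub>R x) (s *\<^sub>R y) = of_real (r * s) * A_inner A x y"
  using assms
  by (simp add: A_inner_def bounded_clinear_scaleR cinner_scaleR_left cinner_scaleR_right)

text \<open>
  If \<open>\<langle>A u, u\<rangle> = 0\<close>, then \<open>t \<mapsto> \<langle>A (v + t u), v + t u\<rangle>\<close> is an affine function of the real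
  variable \<open>t\<close> with slope \<open>2 Re \<langle>A u, v\<rangle>\<close>. It is nonnegative, hence has slope zero. With
  \<open>v = A u\<close> the slope is \<open>2 \<parallel>A u\<parallel>\<^sup>2\<close>.
\<close>

lemma positive_op_null:
  assumes A: "positive_op A" and u: "Re (A_inner A u u) = 0"
  shows "A u = 0"
proof (rule ccontr)
  assume "A u \<noteq> 0"
  define v where "v = A u"
  define c where "c = Re (cinner (A v) v)"
  define d where "d = (norm v)\<^sup>2"
  have d: "d > 0" using \<open>A u \<noteq> 0\<close> by (simp add: d_def v_def)
  have bl: "bounded_clinear A" using A by (rule positive_op_bounded_clinear)
  have uv: "cinner (A u) v = of_real d" "cinner (A v) u = of_real d"
    using positive_op_cinner_commute[OF A, of v u] by (simp_all add: v_def d_def cinner_self)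
  have affine: "0 \<le> c + 2 * t * d" for t :: real
  proof -
    have "cinner (A (v + t *\<^sub>R u)) (v + t *\<^sub>R u)
        = cinner (A v) v + of_real t * cinner (A v) u
          + of_real t * (cinner (A u) v + of_real t * cinner (A u) u)"
      by (simp add: bounded_clinear_add[OF bl] bounded_clinear_scaleR[OF bl] cinner_add_left
          cinner_add_right cinner_scaleR_left cinner_scaleR_right algebra_simps)
    then have "Re (cinner (A (v + t *\<^sub>R u)) (v + t *\<^sub>R u)) = c + 2 * t * d"
      using u by (simp add: uv c_def A_inner_def)
    then show ?thesis
      using positive_op_A_inner_nonneg[OF A, of "v + t *\<^sub>R u"] by (simp add: A_inner_def)
  qed
  \<comment> \<open>This \<open>t\<close> is where the affine function takes the value \<open>- 1\<close>.\<close>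
  have "0 \<le> c + 2 * (- (c + 1) / (2 * d)) * d" by (rule affine)
  also have "\<dots> = - 1" using d by (simp add: field_simps)
  finally show False by simp
qed

lemma cmod_A_inner_le_A_numerical_radius:
  assumes A: "positive_op A" and T: "bounded_clinear T"
  shows "ennreal (cmod (A_inner A (T u) u)) \<le> A_numerical_radius A T * ennreal (Re (A_inner A u u))"
proof (cases "Re (A_inner A u u) = 0")
  case True
  then have "A u = 0" using positive_op_null[OF A] by blast
  then have "A_inner A (T u) u = cinner (T u) 0"
    using positive_op_cinner_commute[OF A, of "T u" u] by (simp add: A_inner_def)
  also have "\<dots> = 0" using cinner_commute[of "T u" 0] by simp
  finally show ?thesis by simp
next
  case False
  define q where "q = Re (A_inner A u u)"
  have q: "q > 0"
    using False positive_op_A_inner_nonneg[OF A, of u] by (simp add: q_def)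
  define v where "v = (1 / sqrt q) *\<^sub>R u"
  have bl: "bounded_clinear A" using A by (rule positive_op_bounded_clinear)
  have rr: "(1 / sqrt q) * (1 / sqrt q) = 1 / q" using q by (simp add: field_simps)
  have "A_inner A v v = of_real (1 / q) * A_inner A u u"
    unfolding v_def A_inner_scaleR[OF bl] rr ..
  then have "Re (A_inner A v v) = 1 / q * Re (A_inner A u u)" by simp
  then have unit: "A_norm A v = 1" using q by (simp add: A_norm_def flip: q_def)
  have "A_inner A (T v) v = of_real (1 / q) * A_inner A (T u) u"
    unfolding v_def bounded_clinear_scaleR[OF T] A_inner_scaleR[OF bl] rr ..
  then have "cmod (A_inner A (T v) v) = 1 / q * cmod (A_inner A (T u) u)"
    using q by (simp add: norm_mult norm_divide)
  then have "cmod (A_inner A (T u) u) = cmod (A_inner A (T v) v) * q"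
    using q by simp
  then have "ennreal (cmod (A_inner A (T u) u)) = ennreal (cmod (A_inner A (T v) v)) * ennreal q"
    using q by (simp add: ennreal_mult)
  also have "\<dots> \<le> A_numerical_radius A T * ennreal q"
    unfolding A_numerical_radius_def using unit by (intro mult_right_mono SUP_upper) auto
  finally show ?thesis by (simp add: q_def)
qed

text \<open>
  A unit vector \<open>u\<close>, placed in the \<open>i\<close>-th summand, is a unit vector of the direct sum at which the
  diagonal operator has the quadratic form \<open>\<langle>T\<^sub>i u, u\<rangle>\<^sub>A\<close>.
\<close>

lemma A_numerical_radius_le_op_diag:
  fixes T :: "'n::finite \<Rightarrow> 'h::chilbert_space \<Rightarrow> 'h"
  assumes A: "bounded_clinear A"
  shows "A_numerical_radius A (T i) \<le> A_numerical_radius (op_diag (\<lambda>_::'n. A)) (op_diag T)"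
  unfolding A_numerical_radius_def
proof (rule SUP_mono)
  fix u assume u: "u \<in> {u. A_norm A u = 1}"
  have form: "A_inner (op_diag (\<lambda>_::'n. A)) y (axis i u) = A_inner A (y $ i) u" for y :: "'h ^ 'n"
  proof -
    have zero: "cinner z 0 = 0" for z :: 'h
      using cinner_commute[of z 0] by simp
    have "A_inner (op_diag (\<lambda>_::'n. A)) y (axis i u)
        = (\<Sum>j\<in>UNIV. if j = i then A_inner A (y $ i) u else 0)"
      unfolding op_diag_const_A_inner
      by (rule sum.cong) (auto simp: axis_def A_inner_def zero)
    then show ?thesis by simp
  qed
  have "A_norm (op_diag (\<lambda>_::'n. A)) (axis i u) = 1"
    using u unfolding A_norm_def form by (simp add: axis_def)
  moreover have "A_inner (op_diag (\<lambda>_::'n. A)) (op_diag T (axis i u)) (axis i u) = A_inner A (T i u) u"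
    unfolding form by (simp add: op_diag_nth axis_def)
  ultimately show "\<exists>x\<in>{x. A_norm (op_diag (\<lambda>_::'n. A)) x = 1}.
      ennreal (cmod (A_inner A (T i u) u))
        \<le> ennreal (cmod (A_inner (op_diag (\<lambda>_::'n. A)) (op_diag T x) x))"
    by (intro bexI[of _ "axis i u"]) simp_all
qed

theorem theorem3p19:
  fixes A :: "'h::chilbert_space \<Rightarrow> 'h"
    and T :: "'n::finite \<Rightarrow> 'h \<Rightarrow> 'h"
  assumes "positive_op A"
    and "\<And>i. T i \<in> adjointable_ops A"
  shows "A_numerical_radius (op_diag (\<lambda>_::'n. A)) (op_diag (\<lambda>_::'n. \<lambda>x. \<Sum>i\<in>UNIV. T i x))
           \<le> of_nat CARD('n) * A_numerical_radius (op_diag (\<lambda>_::'n. A)) (op_diag T)"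
proof -
  define w where "w = A_numerical_radius (op_diag (\<lambda>_::'n. A)) (op_diag T)"
  have A: "bounded_clinear A" using assms(1) by (rule positive_op_bounded_clinear)
  have T: "bounded_clinear (T i)" for i using assms(2)[of i] by (simp add: adjointable_ops_def)
  have entry: "ennreal (cmod (A_inner A (T i u) u)) \<le> w * ennreal (Re (A_inner A u u))" for i u
  proof -
    have "ennreal (cmod (A_inner A (T i u) u))
        \<le> A_numerical_radius A (T i) * ennreal (Re (A_inner A u u))"
      using assms(1) T by (rule cmod_A_inner_le_A_numerical_radius)
    also have "\<dots> \<le> w * ennreal (Re (A_inner A u u))"
      unfolding w_def by (intro mult_right_mono A_numerical_radius_le_op_diag A) simp
    finally show ?thesis .
  qed
  have "ennreal (cmod (A_inner (op_diag (\<lambda>_::'n. A)) (op_diag (\<lambda>_::'n. \<lambda>x. \<Sum>i\<in>UNIV. T i x) x) x))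
      \<le> of_nat CARD('n) * w"
    if x: "A_norm (op_diag (\<lambda>_::'n. A)) x = 1" for x :: "'h ^ 'n"
  proof -
    have unit: "(\<Sum>j\<in>UNIV. Re (A_inner A (x $ j) (x $ j))) = 1"
      using x by (simp add: A_norm_def op_diag_const_A_inner)
    have "A_inner (op_diag (\<lambda>_::'n. A)) (op_diag (\<lambda>_::'n. \<lambda>x. \<Sum>i\<in>UNIV. T i x) x) x
        = (\<Sum>j\<in>UNIV. \<Sum>i\<in>UNIV. A_inner A (T i (x $ j)) (x $ j))"
      by (simp add: op_diag_const_A_inner op_diag_nth A_inner_sum_left[OF A])
    also have "cmod \<dots> \<le> (\<Sum>j\<in>UNIV. \<Sum>i\<in>UNIV. cmod (A_inner A (T i (x $ j)) (x $ j)))"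
      by (intro order_trans[OF norm_sum] sum_mono norm_sum)
    finally have "ennreal (cmod (A_inner (op_diag (\<lambda>_::'n. A))
          (op_diag (\<lambda>_::'n. \<lambda>x. \<Sum>i\<in>UNIV. T i x) x) x))
        \<le> (\<Sum>j\<in>UNIV. \<Sum>i\<in>UNIV. ennreal (cmod (A_inner A (T i (x $ j)) (x $ j))))"
      by (simp add: sum_nonneg ennreal_leI)
    also have "\<dots> \<le> (\<Sum>j\<in>UNIV. \<Sum>i\<in>(UNIV::'n set). w * ennreal (Re (A_inner A (x $ j) (x $ j))))"
      by (intro sum_mono entry)
    also have "\<dots> = of_nat CARD('n) * (w * (\<Sum>j\<in>UNIV. ennreal (Re (A_inner A (x $ j) (x $ j)))))"
      by (simp add: sum_distrib_left)
    also have "(\<Sum>j\<in>UNIV. ennreal (Re (A_inner A (x $ j) (x $ j)))) = 1"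
      using unit by (simp add: positive_op_A_inner_nonneg[OF assms(1)])
    finally show ?thesis by simp
  qed
  then show ?thesis
    unfolding w_def[symmetric] A_numerical_radius_def[of _ "op_diag (\<lambda>_. \<lambda>x. \<Sum>i\<in>UNIV. T i x)"]
    by (intro SUP_least) auto
qed

end
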